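(* Let $(M,g,X,\lambda)$ be a compact oriented gradient Yamabe soliton of dimension $n\ge 2$ with potential function $f$, so that $X=\nabla f$, and let $h$ be the Hodge-de Rham potential of $X$. Then $f$ agrees with $h$ up to a constant, i.e. there is a constant $C$ such that $f=h+C$ on $M$.
   Context: A Yamabe soliton $(M,g,X,\lambda)$ of dimension $n$ ($n\ge 2$) is a connected Riemannian manifold $(M,g)$ of dimension $n$ with a smooth vector field $X$ and a constant $\lambda\in\mathbb{R}$ such that $\frac12\mathcal{L}_X g=(R-\lambda)g$, where $\mathcal{L}_X g$ is the Lie derivative of $g$ along $X$ and $R$ is the scalar curvature. It is a gradient Yamabe soliton with potential function $f$ if $X=\nabla f$ for a smooth function $f:M\to\mathbb{R}$; then the equation becomes $\nabla^2 f=(R-\lambda)g$, with $\nabla^2 f$ the Hessian of $f$. On a compact oriented Riemannian manifold, by the Hodge-de Rham decomposition theorem a smooth vector field $X$ can be written as $X=Y+\nabla h$ with $\operatorname{div}Y=0$ and $h$ a smooth function; the function $h$ is called the Hodge-de Rham potential of $X$. *)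

theory Defs
  imports "HOL-Analysis.Analysis"
begin

text \<open>
  Manifolds are topologies equipped with a smooth atlas of charts into \<open>real ^ 'n\<close>, so the
  dimension is \<open>CARD('n)\<close>. Tensor fields are families of component functions, one for each chart
  of the atlas, which are related by the tensor transformation law on chart overlaps. All component
  functions are functions on the manifold itself; their values outside the chart domain are
  irrelevant.
\<close>

section \<open>Smooth maps between Euclidean spaces\<close>

primrec higher_differentiable_on ::
  "nat \<Rightarrow> 'a::real_normed_vector set \<Rightarrow> ('a \<Rightarrow> 'b::real_normed_vector) \<Rightarrow> bool" where
  "higher_differentiable_on 0 S f \<longleftrightarrow> continuous_on S f"
| "higher_differentiable_on (Suc k) S f \<longleftrightarrow>
     (\<forall>x\<in>S. f differentiable at x) \<and>
     (\<forall>v. higher_differentiable_on k S (\<lambda>x. frechet_derivative f (at x) v))"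

text \<open>Only used for open \<open>S\<close>.\<close>
definition smooth_on :: "'a::real_normed_vector set \<Rightarrow> ('a \<Rightarrow> 'b::real_normed_vector) \<Rightarrow> bool" where
  "smooth_on S f \<longleftrightarrow> (\<forall>k. higher_differentiable_on k S f)"

section \<open>Smooth manifolds\<close>

type_synonym ('a, 'n) chart = "'a set \<times> ('a \<Rightarrow> (real, 'n) vec)"

abbreviation cdom :: "('a, 'n::finite) chart \<Rightarrow> 'a set" where
  "cdom c \<equiv> fst c"

abbreviation cmap :: "('a, 'n::finite) chart \<Rightarrow> 'a \<Rightarrow> real ^ 'n" where
  "cmap c \<equiv> snd c"

abbreviation cran :: "('a, 'n::finite) chart \<Rightarrow> (real ^ 'n) set" where
  "cran c \<equiv> cmap c ` cdom c"

abbreviation cinv :: "('a, 'n::finite) chart \<Rightarrow> real ^ 'n \<Rightarrow> 'a" where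
  "cinv c \<equiv> inv_into (cdom c) (cmap c)"

definition is_chart :: "'a topology \<Rightarrow> ('a, 'n::finite) chart \<Rightarrow> bool" where
  "is_chart T c \<longleftrightarrow>
     openin T (cdom c) \<and> open (cran c) \<and>
     homeomorphic_map (subtopology T (cdom c)) (top_of_set (cran c)) (cmap c)"

definition trans_map ::
  "('a, 'n::finite) chart \<Rightarrow> ('a, 'n) chart \<Rightarrow> real ^ 'n \<Rightarrow> real ^ 'n" where
  "trans_map c d = cmap d \<circ> cinv c"

definition trans_jac ::
  "('a, 'n::finite) chart \<Rightarrow> ('a, 'n) chart \<Rightarrow> 'a \<Rightarrow> real ^ 'n ^ 'n" where
  "trans_jac c d p = jacobian (trans_map c d) (at (cmap c p))"

definition smooth_atlas :: "'a topology \<Rightarrow> ('a, 'n::finite) chart set \<Rightarrow> bool" where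
  "smooth_atlas T A \<longleftrightarrow>
     (\<forall>c\<in>A. is_chart T c) \<and> (\<Union>c\<in>A. cdom c) = topspace T \<and>
     (\<forall>c\<in>A. \<forall>d\<in>A. smooth_on (cmap c ` (cdom c \<inter> cdom d)) (trans_map c d))"

definition smooth_manifold :: "'a topology \<Rightarrow> ('a, 'n::finite) chart set \<Rightarrow> bool" where
  "smooth_manifold T A \<longleftrightarrow> Hausdorff_space T \<and> second_countable T \<and> smooth_atlas T A"

text \<open>An orientation of the smooth manifold \<open>(T, A)\<close> is given by an atlas \<open>B\<close> of the same smooth
  structure, all of whose coordinate changes preserve the orientation of \<open>real ^ 'n\<close>. The given atlas
  \<open>A\<close> itself need not be oriented.\<close>
definition orientation_atlas ::
  "'a topology \<Rightarrow> ('a, 'n::finite) chart set \<Rightarrow> ('a, 'n) chart set \<Rightarrow> bool" where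
  "orientation_atlas T A B \<longleftrightarrow>
     smooth_atlas T B \<and> smooth_atlas T (A \<union> B) \<and>
     (\<forall>c\<in>B. \<forall>d\<in>B. \<forall>p\<in>cdom c \<inter> cdom d. det (trans_jac c d p) > 0)"

section \<open>Functions, vector fields and metrics\<close>

text \<open>\<open>chart_deriv c i u\<close> is \<open>\<partial>u/\<partial>x\<^sup>i\<close> with respect to the coordinates \<open>x\<close> of the chart \<open>c\<close>.\<close>
definition chart_deriv ::
  "('a, 'n::finite) chart \<Rightarrow> 'n \<Rightarrow> ('a \<Rightarrow> real) \<Rightarrow> 'a \<Rightarrow> real" where
  "chart_deriv c i u p = frechet_derivative (u \<circ> cinv c) (at (cmap c p)) (axis i 1)"

definition smooth_in_chart ::
  "('a, 'n::finite) chart \<Rightarrow> ('a \<Rightarrow> 'b::real_normed_vector) \<Rightarrow> bool" where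
  "smooth_in_chart c u \<longleftrightarrow> smooth_on (cran c) (u \<circ> cinv c)"

definition smooth_function :: "('a, 'n::finite) chart set \<Rightarrow> ('a \<Rightarrow> real) \<Rightarrow> bool" where
  "smooth_function A f \<longleftrightarrow> (\<forall>c\<in>A. smooth_in_chart c f)"

type_synonym ('a, 'n) vfield = "('a, 'n) chart \<Rightarrow> 'a \<Rightarrow> (real, 'n) vec"

type_synonym ('a, 'n) tensor2 = "('a, 'n) chart \<Rightarrow> 'a \<Rightarrow> ((real, 'n) vec, 'n) vec"

definition smooth_vector_field ::
  "('a, 'n::finite) chart set \<Rightarrow> ('a, 'n) vfield \<Rightarrow> bool" where
  "smooth_vector_field A X \<longleftrightarrow>
     (\<forall>c\<in>A. smooth_in_chart c (X c)) \<and>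
     (\<forall>c\<in>A. \<forall>d\<in>A. \<forall>p\<in>cdom c \<inter> cdom d. X d p = trans_jac c d p *v X c p)"

definition riemannian_metric ::
  "('a, 'n::finite) chart set \<Rightarrow> ('a, 'n) tensor2 \<Rightarrow> bool" where
  "riemannian_metric A g \<longleftrightarrow>
     (\<forall>c\<in>A. smooth_in_chart c (g c)) \<and>
     (\<forall>c\<in>A. \<forall>d\<in>A. \<forall>p\<in>cdom c \<inter> cdom d.
        g c p = transpose (trans_jac c d p) ** g d p ** trans_jac c d p) \<and>
     (\<forall>c\<in>A. \<forall>p\<in>cdom c.
        transpose (g c p) = g c p \<and> (\<forall>v. v \<noteq> 0 \<longrightarrow> v \<bullet> (g c p *v v) > 0))"

section \<open>Operators of Riemannian geometry\<close>

text \<open>The metric with upper indices, \<open>g\<^sup>i\<^sup>j\<close>.\<close>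
definition inv_metric :: "('a, 'n::finite) tensor2 \<Rightarrow> ('a, 'n) tensor2" where
  "inv_metric g c p = matrix_inv (g c p)"

text \<open>\<open>(\<nabla>f)\<^sup>i = g\<^sup>i\<^sup>j \<partial>\<^sub>j f\<close>\<close>
definition gradient :: "('a, 'n::finite) tensor2 \<Rightarrow> ('a \<Rightarrow> real) \<Rightarrow> ('a, 'n) vfield" where
  "gradient g f c p = inv_metric g c p *v (\<chi> j. chart_deriv c j f p)"

text \<open>Christoffel symbols of the Levi-Civita connection:
  \<open>christoffel g c k i j\<close> is \<open>\<Gamma>\<^sup>k\<^sub>i\<^sub>j = 1/2 g\<^sup>k\<^sup>l (\<partial>\<^sub>i g\<^sub>j\<^sub>l + \<partial>\<^sub>j g\<^sub>i\<^sub>l - \<partial>\<^sub>l g\<^sub>i\<^sub>j)\<close>.\<close>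
definition christoffel ::
  "('a, 'n::finite) tensor2 \<Rightarrow> ('a, 'n) chart \<Rightarrow> 'n \<Rightarrow> 'n \<Rightarrow> 'n \<Rightarrow> 'a \<Rightarrow> real" where
  "christoffel g c k i j p =
     1/2 * (\<Sum>l\<in>UNIV. inv_metric g c p $ k $ l *
        (chart_deriv c i (\<lambda>q. g c q $ j $ l) p + chart_deriv c j (\<lambda>q. g c q $ i $ l) p
          - chart_deriv c l (\<lambda>q. g c q $ i $ j) p))"

text \<open>The divergence is the trace of the covariant derivative:
  \<open>div X = \<nabla>\<^sub>i X\<^sup>i = \<partial>\<^sub>i X\<^sup>i + \<Gamma>\<^sup>i\<^sub>i\<^sub>k X\<^sup>k\<close>.\<close>
definition divergence ::
  "('a, 'n::finite) tensor2 \<Rightarrow> ('a, 'n) vfield \<Rightarrow> ('a, 'n) chart \<Rightarrow> 'a \<Rightarrow> real" where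
  "divergence g X c p =
     (\<Sum>i\<in>UNIV. chart_deriv c i (\<lambda>q. X c q $ i) p
        + (\<Sum>k\<in>UNIV. christoffel g c i i k p * X c p $ k))"

text \<open>\<open>riemann g c l i j k\<close> is the \<open>\<partial>\<^sub>l\<close>-component of \<open>R(\<partial>\<^sub>i, \<partial>\<^sub>j) \<partial>\<^sub>k\<close>, where
  \<open>R(X, Y) Z = \<nabla>\<^sub>X \<nabla>\<^sub>Y Z - \<nabla>\<^sub>Y \<nabla>\<^sub>X Z - \<nabla>\<^bsub>[X,Y]\<^esub> Z\<close>.\<close>
definition riemann ::
  "('a, 'n::finite) tensor2 \<Rightarrow> ('a, 'n) chart \<Rightarrow> 'n \<Rightarrow> 'n \<Rightarrow> 'n \<Rightarrow> 'n \<Rightarrow> 'a \<Rightarrow> real" where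
  "riemann g c l i j k p =
     chart_deriv c i (christoffel g c l j k) p - chart_deriv c j (christoffel g c l i k) p
     + (\<Sum>m\<in>UNIV. christoffel g c l i m p * christoffel g c m j k p
                 - christoffel g c l j m p * christoffel g c m i k p)"

definition ricci ::
  "('a, 'n::finite) tensor2 \<Rightarrow> ('a, 'n) chart \<Rightarrow> 'n \<Rightarrow> 'n \<Rightarrow> 'a \<Rightarrow> real" where
  "ricci g c j k p = (\<Sum>i\<in>UNIV. riemann g c i i j k p)"

text \<open>As for every scalar invariant, the value does not depend on the chart \<open>c\<close> around \<open>p\<close> in which
  it is computed.\<close>
definition scalar_curvature ::
  "('a, 'n::finite) tensor2 \<Rightarrow> ('a, 'n) chart \<Rightarrow> 'a \<Rightarrow> real" where
  "scalar_curvature g c p = (\<Sum>j\<in>UNIV. \<Sum>k\<in>UNIV. inv_metric g c p $ j $ k * ricci g c j k p)"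

text \<open>\<open>(L\<^sub>X g)\<^sub>i\<^sub>j = X\<^sup>k \<partial>\<^sub>k g\<^sub>i\<^sub>j + g\<^sub>k\<^sub>j \<partial>\<^sub>i X\<^sup>k + g\<^sub>i\<^sub>k \<partial>\<^sub>j X\<^sup>k\<close>\<close>
definition lie_derivative ::
  "('a, 'n::finite) vfield \<Rightarrow> ('a, 'n) tensor2 \<Rightarrow> ('a, 'n) tensor2" where
  "lie_derivative X g c p =
     (\<chi> i j. \<Sum>k\<in>UNIV. X c p $ k * chart_deriv c k (\<lambda>q. g c q $ i $ j) p
        + g c p $ k $ j * chart_deriv c i (\<lambda>q. X c q $ k) p
        + g c p $ i $ k * chart_deriv c j (\<lambda>q. X c q $ k) p)"

section \<open>Yamabe solitons\<close>

definition yamabe_soliton ::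
  "'a topology \<Rightarrow> ('a, 'n::finite) chart set \<Rightarrow> ('a, 'n) tensor2 \<Rightarrow> ('a, 'n) vfield \<Rightarrow> real \<Rightarrow> bool"
where
  "yamabe_soliton T A g X lam \<longleftrightarrow>
     smooth_manifold T A \<and> connected_space T \<and> CARD('n) \<ge> 2 \<and>
     riemannian_metric A g \<and> smooth_vector_field A X \<and>
     (\<forall>c\<in>A. \<forall>p\<in>cdom c.
        (1/2) *\<^sub>R lie_derivative X g c p = (scalar_curvature g c p - lam) *\<^sub>R g c p)"

definition gradient_yamabe_soliton ::
  "'a topology \<Rightarrow> ('a, 'n::finite) chart set \<Rightarrow> ('a, 'n) tensor2 \<Rightarrow> ('a, 'n) vfield \<Rightarrow> real
    \<Rightarrow> ('a \<Rightarrow> real) \<Rightarrow> bool"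
where
  "gradient_yamabe_soliton T A g X lam f \<longleftrightarrow>
     yamabe_soliton T A g X lam \<and> smooth_function A f \<and>
     (\<forall>c\<in>A. \<forall>p\<in>cdom c. X c p = gradient g f c p)"

text \<open>Such an \<open>h\<close> is determined by \<open>X\<close> only up to an additive constant, so this is a predicate.\<close>
definition hodge_de_rham_potential ::
  "('a, 'n::finite) chart set \<Rightarrow> ('a, 'n) tensor2 \<Rightarrow> ('a, 'n) vfield \<Rightarrow> ('a \<Rightarrow> real) \<Rightarrow> bool"
where
  "hodge_de_rham_potential A g X h \<longleftrightarrow>
     smooth_function A h \<and>
     (\<exists>Y. smooth_vector_field A Y \<and>
        (\<forall>c\<in>A. \<forall>p\<in>cdom c. divergence g Y c p = 0) \<and>
        (\<forall>c\<in>A. \<forall>p\<in>cdom c. X c p = Y c p + gradient g h c p))"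

end

theory Submission
  imports Defs
begin

text \<open>
  Let \<open>X = \<nabla>f = Y + \<nabla>h\<close> with \<open>div Y = 0\<close>. Then \<open>Y\<close> is the gradient of \<open>u = f - h\<close>, so \<open>u\<close> is harmonic,
  and a harmonic function on a compact connected manifold is constant.

  The last fact follows from the maximum principle, which is local and can be applied in charts.
  By compactness \<open>u\<close> attains its maximum. In a chart the equation
  \<open>div \<nabla>u = 0\<close> is a linear elliptic equation of second order with continuous coefficients and no
  term of order zero (\<open>harmonic_constant_near_max\<close>), so by Hopf's strong maximum principle
  (\<open>strong_maximum_principle\<close>) \<open>u\<close> is constant near every point where it attains the maximum. The
  set of these points is therefore open; it is also closed, and connectedness finishes the proof
  (\<open>harmonic_function_constant\<close>).

  The strong maximum principle rests on two facts: an elliptic operator without zero-order term is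
  nonpositive at an interior maximum (\<open>elliptic_nonpos_at_max\<close>), and it is positive on a steep
  Gaussian away from its centre (\<open>barrier_derivatives\<close>).
\<close>

section \<open>Elliptic operators at an interior maximum\<close>

text \<open>This is the step by which a positive definite symbol meets the sign of a Hessian. A positive
  definite \<open>M\<close> is a sum of rank-one matrices \<open>m m\<^sup>T\<close>, and the pairing of \<open>m m\<^sup>T\<close> with \<open>H\<close> is the
  value of the form \<open>H\<close> at \<open>m\<close>. They are split off one index at a time, as in the Cholesky
  decomposition, and each step keeps the remaining form positive definite.\<close>
lemma posdef_pairing_nonpos:
  fixes M H :: "'i \<Rightarrow> 'i \<Rightarrow> real"
  assumes "finite S"
    and "\<And>i j. M i j = M j i"
    and "\<And>v. \<exists>i\<in>S. v i \<noteq> 0 \<Longrightarrow> 0 < (\<Sum>i\<in>S. \<Sum>j\<in>S. M i j * v i * v j)"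
    and "\<And>v. (\<Sum>i\<in>S. \<Sum>j\<in>S. H i j * v i * v j) \<le> 0"
  shows "(\<Sum>i\<in>S. \<Sum>j\<in>S. M i j * H i j) \<le> 0"
  using assms
proof (induction S arbitrary: M rule: finite_induct)
  case empty
  then show ?case by simp
next
  case (insert k F)
  note sym = insert.prems(1) and pos = insert.prems(2) and neg = insert.prems(3)
  have split: "(\<Sum>i\<in>insert k F. \<Sum>j\<in>insert k F. Q i j) =
      Q k k + (\<Sum>j\<in>F. Q k j) + (\<Sum>i\<in>F. Q i k) + (\<Sum>i\<in>F. \<Sum>j\<in>F. Q i j)" for Q :: "'i \<Rightarrow> 'i \<Rightarrow> real"
    using insert.hyps by (simp add: sum.distrib)
  have cong_F: "(\<Sum>i\<in>F. q i * (v(k := t)) i) = (\<Sum>i\<in>F. q i * v i)" for q v and t :: real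
    using insert.hyps by (intro sum.cong) auto
  have cong_FF: "(\<Sum>i\<in>F. \<Sum>j\<in>F. Q i j * (v(k := t)) i * (v(k := t)) j)
      = (\<Sum>i\<in>F. \<Sum>j\<in>F. Q i j * v i * v j)" for Q v and t :: real
    using insert.hyps by (intro sum.cong refl) auto
  define c where "c = M k k"
  have c: "c > 0"
  proof -
    define u :: "'i \<Rightarrow> real" where "u i = (if i = k then 1 else 0)" for i
    have u: "u k = 1" "\<And>i. i \<in> F \<Longrightarrow> u i = 0"
      using insert.hyps by (auto simp: u_def)
    have "0 < (\<Sum>i\<in>insert k F. \<Sum>j\<in>insert k F. M i j * u i * u j)"
      by (rule pos) (use u in auto)
    then show ?thesis
      unfolding split by (simp add: u c_def cong: sum.cong_simp)
  qed
  \<comment> \<open>The Schur complement of the pivot \<open>c\<close>: row and column \<open>k\<close> vanish, and the rest stays positive definite.\<close>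
  define M' where "M' i j = M i j - M k i * M k j / c" for i j
  have "(\<Sum>i\<in>F. \<Sum>j\<in>F. M' i j * H i j) \<le> 0"
  proof (rule insert.IH)
    show "M' i j = M' j i" for i j
      unfolding M'_def using sym[of i j] by (simp add: mult.commute)
  next
    fix v :: "'i \<Rightarrow> real"
    assume v: "\<exists>i\<in>F. v i \<noteq> 0"
    define s where "s = (\<Sum>j\<in>F. M k j * v j)"
    \<comment> \<open>The value at \<open>k\<close> that minimises the form of \<open>M\<close> over all extensions of \<open>v\<close>.\<close>
    define v' where "v' = v(k := - s / c)"
    have "\<exists>i\<in>insert k F. v' i \<noteq> 0"
      using v insert.hyps by (auto simp: v'_def)
    then have "0 < (\<Sum>i\<in>insert k F. \<Sum>j\<in>insert k F. M i j * v' i * v' j)"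
      by (rule pos)
    also have "\<dots> = M k k * v' k * v' k + v' k * (\<Sum>j\<in>F. M k j * v' j)
         + v' k * (\<Sum>j\<in>F. M k j * v' j) + (\<Sum>i\<in>F. \<Sum>j\<in>F. M i j * v' i * v' j)"
    proof -
      have "(\<Sum>i\<in>F. M i k * v' i * v' k) = v' k * (\<Sum>j\<in>F. M k j * v' j)"
        unfolding sum_distrib_left by (intro sum.cong refl) (simp add: sym[of _ k])
      moreover have "(\<Sum>j\<in>F. M k j * v' k * v' j) = v' k * (\<Sum>j\<in>F. M k j * v' j)"
        unfolding sum_distrib_left by (intro sum.cong refl) simp
      ultimately show ?thesis
        unfolding split by simp
    qed
    also have "\<dots> = (\<Sum>i\<in>F. \<Sum>j\<in>F. M i j * v i * v j) - s * s / c"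
      unfolding v'_def cong_FF unfolding cong_F s_def[symmetric] c_def[symmetric] using c
      by (simp add: field_simps)
    also have "s * s / c = (\<Sum>i\<in>F. \<Sum>j\<in>F. M k i * M k j / c * v i * v j)"
      unfolding s_def sum_product sum_divide_distrib by (intro sum.cong refl) simp
    finally show "0 < (\<Sum>i\<in>F. \<Sum>j\<in>F. M' i j * v i * v j)"
      unfolding M'_def by (simp add: left_diff_distrib sum_subtractf)
  next
    fix v :: "'i \<Rightarrow> real"
    have "(\<Sum>i\<in>insert k F. \<Sum>j\<in>insert k F. H i j * (v(k := 0)) i * (v(k := 0)) j) \<le> 0"
      by (rule neg)
    then show "(\<Sum>i\<in>F. \<Sum>j\<in>F. H i j * v i * v j) \<le> 0"
      unfolding split cong_FF by simp
  qed
  moreover have "(\<Sum>i\<in>insert k F. \<Sum>j\<in>insert k F. M k i * M k j / c * H i j) \<le> 0"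
  proof -
    have "(\<Sum>i\<in>insert k F. \<Sum>j\<in>insert k F. M k i * M k j / c * H i j)
        = (\<Sum>i\<in>insert k F. \<Sum>j\<in>insert k F. H i j * M k i * M k j) / c"
      unfolding sum_divide_distrib by (intro sum.cong refl) simp
    then show ?thesis
      using neg[of "M k"] c by (simp add: divide_nonpos_pos)
  qed
  moreover have "(\<Sum>i\<in>insert k F. \<Sum>j\<in>insert k F. M i j * H i j) =
      (\<Sum>i\<in>insert k F. \<Sum>j\<in>insert k F. M k i * M k j / c * H i j)
      + (\<Sum>i\<in>insert k F. \<Sum>j\<in>insert k F. M' i j * H i j)"
    unfolding sum.distrib[symmetric] M'_def by (intro sum.cong refl) (simp add: algebra_simps)
  moreover have "(\<Sum>i\<in>insert k F. \<Sum>j\<in>insert k F. M' i j * H i j) = (\<Sum>i\<in>F. \<Sum>j\<in>F. M' i j * H i j)"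
  proof -
    have "M' k j = 0" "M' j k = 0" for j
      using c sym[of j k] by (auto simp: M'_def c_def)
    then show ?thesis
      unfolding split by simp
  qed
  ultimately show ?case by linarith
qed

lemma second_derivative_nonpos_at_max:
  fixes \<psi> \<psi>' :: "real \<Rightarrow> real"
  assumes d: "d > 0"
    and max: "\<And>t. \<bar>t\<bar> < d \<Longrightarrow> \<psi> t \<le> \<psi> 0"
    and der: "\<And>t. \<bar>t\<bar> < d \<Longrightarrow> (\<psi> has_real_derivative \<psi>' t) (at t)"
    and der2: "(\<psi>' has_real_derivative l) (at 0)"
  shows "\<psi>' 0 = 0" and "l \<le> 0"
proof -
  show 0: "\<psi>' 0 = 0"
  proof (rule DERIV_local_max[OF der d])
    show "\<forall>t. \<bar>0 - t\<bar> < d \<longrightarrow> \<psi> t \<le> \<psi> 0"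
      using max by simp
  qed (use d in simp)
  show "l \<le> 0"
  proof (rule ccontr)
    assume "\<not> l \<le> 0"
    then have "\<exists>e>0. \<forall>t>0. t < e \<longrightarrow> \<psi>' 0 < \<psi>' (0 + t)"
      by (intro DERIV_pos_inc_right[OF der2]) simp
    then obtain e where e: "e > 0" "\<And>t. 0 < t \<Longrightarrow> t < e \<Longrightarrow> \<psi>' 0 < \<psi>' (0 + t)"
      by blast
    define t where "t = min d e / 2"
    have t: "0 < t" "t < d" "t < e"
      using d e(1) by (auto simp: t_def min_def)
    have "\<psi> 0 < \<psi> t"
    proof (rule DERIV_pos_imp_increasing_open[OF t(1)])
      fix s assume "0 < s" "s < t"
      then show "\<exists>y. (\<psi> has_real_derivative y) (at s) \<and> 0 < y"
        using t e(2)[of s] 0 by (intro exI[of _ "\<psi>' s"] conjI der) simp_all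
    next
      show "continuous_on {0..t} \<psi>"
        by (rule DERIV_continuous_on[OF has_field_derivative_at_within[OF der]]) (use t in simp)
    qed
    with max[of t] t show False by simp
  qed
qed

text \<open>Restriction to a line through the maximum reduces this to functions of one variable. Partial
  derivatives are passed as functions \<open>D1\<close> and numbers \<open>D2\<close>, so that they can be given in whatever
  form is convenient.\<close>
lemma hessian_nonpos_at_max:
  fixes \<phi> :: "real ^ 'n \<Rightarrow> real"
  assumes U: "open U" "x \<in> U"
    and max: "\<And>y. y \<in> U \<Longrightarrow> \<phi> y \<le> \<phi> x"
    and d1: "\<And>y. y \<in> U \<Longrightarrow> (\<phi> has_derivative (\<lambda>h. \<Sum>j\<in>UNIV. h $ j * D1 j y)) (at y)"
    and d2: "\<And>j. (D1 j has_derivative (\<lambda>h. \<Sum>i\<in>UNIV. h $ i * D2 i j)) (at x)"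
  shows "D1 j x = 0" and "(\<Sum>i\<in>UNIV. \<Sum>j\<in>UNIV. D2 i j * v i * v j) \<le> 0"
proof -
  have *: "(\<Sum>j\<in>UNIV. v j * D1 j x) = 0 \<and> (\<Sum>i\<in>UNIV. \<Sum>j\<in>UNIV. D2 i j * v i * v j) \<le> 0" for v
  proof -
    define w :: "real ^ 'n" where "w = (\<chi> i. v i)"
    obtain e where e: "e > 0" "ball x e \<subseteq> U"
      using U openE by blast
    define d where "d = e / (norm w + 1)"
    have d: "d > 0"
      using e(1) by (auto simp: d_def add_nonneg_pos)
    have inU: "x + t *\<^sub>R w \<in> U" if "\<bar>t\<bar> < d" for t
    proof -
      have "\<bar>t\<bar> * norm w \<le> \<bar>t\<bar> * (norm w + 1)"
        by (simp add: mult_left_mono)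
      also have "\<dots> < e"
        using that by (simp add: d_def pos_less_divide_eq add_nonneg_pos)
      finally show ?thesis
        using e(2) by (auto simp: dist_norm)
    qed
    have line: "((\<lambda>t. x + t *\<^sub>R w) has_derivative (\<lambda>s. s *\<^sub>R w)) (at t)" for t
      by (auto intro!: derivative_eq_intros)
    define \<psi>' where "\<psi>' t = (\<Sum>j\<in>UNIV. v j * D1 j (x + t *\<^sub>R w))" for t
    have D1: "((\<lambda>t. \<phi> (x + t *\<^sub>R w)) has_real_derivative \<psi>' t) (at t)" if "\<bar>t\<bar> < d" for t
      unfolding has_field_derivative_def
      using has_derivative_compose[OF line[of t] d1[OF inU[OF that]]]
      by (rule has_derivative_eq_rhs) (auto simp: fun_eq_iff \<psi>'_def w_def sum_distrib_right sum_distrib_left ac_simps)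
    have "((\<lambda>t. D1 j (x + t *\<^sub>R w)) has_derivative (\<lambda>s. \<Sum>i\<in>UNIV. (s *\<^sub>R w) $ i * D2 i j)) (at 0)" for j
      by (rule has_derivative_compose[OF line[of 0], of "D1 j", simplified]) (use d2 in simp)
    then have "(\<psi>' has_derivative (\<lambda>s. \<Sum>j\<in>UNIV. v j * (\<Sum>i\<in>UNIV. (s *\<^sub>R w) $ i * D2 i j))) (at 0)"
      unfolding \<psi>'_def by (intro has_derivative_sum has_derivative_mult_right)
    moreover have "(\<lambda>s. \<Sum>j\<in>UNIV. v j * (\<Sum>i\<in>UNIV. (s *\<^sub>R w) $ i * D2 i j))
        = (*) (\<Sum>i\<in>UNIV. \<Sum>j\<in>UNIV. D2 i j * v i * v j)"
    proof
      fix s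
      have "(\<Sum>j\<in>UNIV. v j * (\<Sum>i\<in>UNIV. (s *\<^sub>R w) $ i * D2 i j))
          = (\<Sum>j\<in>UNIV. \<Sum>i\<in>UNIV. D2 i j * v i * v j * s)"
        by (simp add: w_def sum_distrib_left ac_simps)
      also have "\<dots> = (\<Sum>i\<in>UNIV. \<Sum>j\<in>UNIV. D2 i j * v i * v j * s)"
        by (rule sum.swap)
      finally show "(\<Sum>j\<in>UNIV. v j * (\<Sum>i\<in>UNIV. (s *\<^sub>R w) $ i * D2 i j))
          = (\<Sum>i\<in>UNIV. \<Sum>j\<in>UNIV. D2 i j * v i * v j) * s"
        by (simp add: sum_distrib_right)
    qed
    ultimately have D2: "(\<psi>' has_real_derivative (\<Sum>i\<in>UNIV. \<Sum>j\<in>UNIV. D2 i j * v i * v j)) (at 0)"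
      unfolding has_field_derivative_def by simp
    have mx: "\<phi> (x + t *\<^sub>R w) \<le> \<phi> (x + 0 *\<^sub>R w)" if "\<bar>t\<bar> < d" for t
      using max[OF inU[OF that]] by simp
    have "\<psi>' 0 = 0"
      by (rule second_derivative_nonpos_at_max(1)[OF d mx D1 D2])
    moreover have "(\<Sum>i\<in>UNIV. \<Sum>j\<in>UNIV. D2 i j * v i * v j) \<le> 0"
      by (rule second_derivative_nonpos_at_max(2)[OF d mx D1 D2])
    ultimately show ?thesis
      by (simp add: \<psi>'_def)
  qed
  show "(\<Sum>i\<in>UNIV. \<Sum>j\<in>UNIV. D2 i j * v i * v j) \<le> 0"
    using * by blast
  show "D1 j x = 0"
    using *[of "\<lambda>i. if i = j then 1 else 0", THEN conjunct1] by (simp add: mult_delta_left)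
qed

text \<open>The weak form of the maximum principle: at an interior maximum the gradient vanishes, so only the
  second-order part of the operator contributes, and there the Hessian is nonpositive.\<close>
lemma elliptic_nonpos_at_max:
  fixes \<phi> :: "real ^ 'n \<Rightarrow> real"
  assumes U: "open U" "x \<in> U"
    and max: "\<And>y. y \<in> U \<Longrightarrow> \<phi> y \<le> \<phi> x"
    and d1: "\<And>y. y \<in> U \<Longrightarrow> (\<phi> has_derivative (\<lambda>h. \<Sum>j\<in>UNIV. h $ j * D1 j y)) (at y)"
    and d2: "\<And>j. (D1 j has_derivative (\<lambda>h. \<Sum>i\<in>UNIV. h $ i * D2 i j)) (at x)"
    and sym: "\<And>i j. a i j = a j i"
    and pos: "\<And>v. \<exists>i. v i \<noteq> 0 \<Longrightarrow> 0 < (\<Sum>i\<in>UNIV. \<Sum>j\<in>UNIV. a i j * v i * v j)"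
  shows "(\<Sum>i\<in>UNIV. \<Sum>j\<in>UNIV. a i j * D2 i j) + (\<Sum>j\<in>UNIV. b j * D1 j x) \<le> 0"
proof -
  have "(\<Sum>i\<in>UNIV. \<Sum>j\<in>UNIV. a i j * D2 i j) \<le> 0"
  proof (rule posdef_pairing_nonpos[OF finite sym _ hessian_nonpos_at_max(2)[OF U max d1 d2]])
    show "0 < (\<Sum>i\<in>UNIV. \<Sum>j\<in>UNIV. a i j * v i * v j)" if "\<exists>i\<in>UNIV. v i \<noteq> 0" for v
      by (rule pos) (use that in blast)
  qed
  moreover have "D1 j x = 0" for j
    by (rule hessian_nonpos_at_max(1)[OF U max d1 d2])
  ultimately show ?thesis by simp
qed

section \<open>The strong maximum principle\<close>

text \<open>The Gaussian is the comparison function of the strong maximum principle: its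
  Hessian has the rank-one term \<open>4 \<alpha>\<^sup>2 (x - y) (x - y)\<^sup>T\<close>, which beats all other terms of an elliptic
  operator away from \<open>y\<close> once \<open>\<alpha>\<close> is large.\<close>
lemma barrier_derivatives:
  fixes y :: "real ^ 'n" and \<alpha> :: real
  defines "w \<equiv> \<lambda>x. exp (- \<alpha> * ((x - y) \<bullet> (x - y)))"
  shows "(w has_derivative (\<lambda>h. \<Sum>j\<in>UNIV. h $ j * (- 2 * \<alpha> * (x - y) $ j * w x))) (at x)"
    and "((\<lambda>x. - 2 * \<alpha> * (x - y) $ j * w x) has_derivative
      (\<lambda>h. \<Sum>i\<in>UNIV. h $ i * ((4 * \<alpha>\<^sup>2 * (x - y) $ i * (x - y) $ j - (if i = j then 2 * \<alpha> else 0)) * w x))) (at x)"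
proof -
  have q: "((\<lambda>x. (x - y) \<bullet> (x - y)) has_derivative (\<lambda>h. 2 * ((x - y) \<bullet> h))) (at x)" for x
    by (rule has_derivative_eq_rhs, (rule derivative_intros)+)
      (simp add: fun_eq_iff inner_commute)
  have w: "(w has_derivative (\<lambda>h. - 2 * \<alpha> * w x * ((x - y) \<bullet> h))) (at x)" for x
    unfolding w_def
    by (rule has_derivative_eq_rhs[OF has_derivative_exp[OF has_derivative_mult_right[OF q]]])
      (simp add: fun_eq_iff)
  show "(w has_derivative (\<lambda>h. \<Sum>j\<in>UNIV. h $ j * (- 2 * \<alpha> * (x - y) $ j * w x))) (at x)"
    by (rule has_derivative_eq_rhs[OF w])
      (simp add: fun_eq_iff inner_vec_def sum_distrib_left ac_simps)
  have c: "((\<lambda>x. (x - y) $ j) has_derivative (\<lambda>h. h $ j)) (at x)"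
    by (rule bounded_linear.has_derivative[OF bounded_linear_vec_nth]) (auto intro!: derivative_eq_intros)
  have d: "((\<lambda>x. - 2 * \<alpha> * (x - y) $ j * w x) has_derivative
      (\<lambda>h. - 2 * \<alpha> * (x - y) $ j * (- 2 * \<alpha> * w x * ((x - y) \<bullet> h)) + - 2 * \<alpha> * h $ j * w x)) (at x)"
    by (rule has_derivative_mult[OF has_derivative_mult_right[OF c] w])
  have e: "h $ j * r = (\<Sum>i\<in>UNIV. h $ i * (if i = j then r else 0))" for h :: "real ^ 'n" and r :: real
    by (simp add: mult_delta_right)
  show "((\<lambda>x. - 2 * \<alpha> * (x - y) $ j * w x) has_derivative
      (\<lambda>h. \<Sum>i\<in>UNIV. h $ i * ((4 * \<alpha>\<^sup>2 * (x - y) $ i * (x - y) $ j - (if i = j then 2 * \<alpha> else 0)) * w x))) (at x)"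
  proof (rule has_derivative_eq_rhs[OF d], rule ext)
    fix h
    have "- 2 * \<alpha> * (x - y) $ j * (- 2 * \<alpha> * w x * ((x - y) \<bullet> h))
        = (\<Sum>i\<in>UNIV. h $ i * (4 * \<alpha>\<^sup>2 * (x - y) $ i * (x - y) $ j * w x))"
      unfolding inner_vec_def sum_distrib_left
      by (intro sum.cong refl) (simp add: power2_eq_square)
    then have "- 2 * \<alpha> * (x - y) $ j * (- 2 * \<alpha> * w x * ((x - y) \<bullet> h)) + - 2 * \<alpha> * h $ j * w x
        = (\<Sum>i\<in>UNIV. h $ i * (4 * \<alpha>\<^sup>2 * (x - y) $ i * (x - y) $ j * w x)) - h $ j * (2 * \<alpha> * w x)"
      by simp
    also have "\<dots> = (\<Sum>i\<in>UNIV. h $ i * ((4 * \<alpha>\<^sup>2 * (x - y) $ i * (x - y) $ j - (if i = j then 2 * \<alpha> else 0)) * w x))"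
      unfolding e[of h "2 * \<alpha> * w x"] sum_subtractf[symmetric] by (intro sum.cong refl) (simp add: algebra_simps)
    finally show "- 2 * \<alpha> * (x - y) $ j * (- 2 * \<alpha> * w x * ((x - y) \<bullet> h)) + - 2 * \<alpha> * h $ j * w x
        = (\<Sum>i\<in>UNIV. h $ i * ((4 * \<alpha>\<^sup>2 * (x - y) $ i * (x - y) $ j - (if i = j then 2 * \<alpha> else 0)) * w x))" .
  qed
qed

text \<open>Hopf's argument. If \<open>v\<close> were not locally constant at its maximum, some point \<open>y\<close> near \<open>x0\<close> would
  have a smaller value. The largest ball about \<open>y\<close> on which \<open>v\<close> stays below the maximum \<open>M\<close> touches
  the set where \<open>v\<close> equals \<open>M\<close> at a point \<open>z\<close>. Adding to \<open>v\<close> a small multiple of a Gaussian whose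
  operator value is positive near \<open>z\<close> gives a function that is smaller on a small sphere about \<open>z\<close>
  than at \<open>z\<close>: on the part of the sphere inside the touching ball because \<open>v\<close> is less than \<open>M\<close>
  there, outside because the Gaussian is smaller. It thus has an interior maximum, against
  \<open>elliptic_nonpos_at_max\<close>.\<close>
lemma strong_maximum_principle:
  fixes v :: "real ^ 'n \<Rightarrow> real"
  assumes U: "open U" "x0 \<in> U"
    and max: "\<And>x. x \<in> U \<Longrightarrow> v x \<le> v x0"
    and d1: "\<And>x. x \<in> U \<Longrightarrow> (v has_derivative (\<lambda>h. \<Sum>j\<in>UNIV. h $ j * D1 j x)) (at x)"
    and d2: "\<And>x j. x \<in> U \<Longrightarrow> (D1 j has_derivative (\<lambda>h. \<Sum>i\<in>UNIV. h $ i * D2 i j x)) (at x)"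
    and a_cont: "\<And>i j. continuous_on U (a i j)"
    and b_cont: "\<And>j. continuous_on U (b j)"
    and sym: "\<And>x i j. x \<in> U \<Longrightarrow> a i j x = a j i x"
    and pos: "\<And>x v. x \<in> U \<Longrightarrow> \<exists>i. v i \<noteq> 0 \<Longrightarrow> 0 < (\<Sum>i\<in>UNIV. \<Sum>j\<in>UNIV. a i j x * v i * v j)"
    and sub: "\<And>x. x \<in> U \<Longrightarrow> 0 \<le> (\<Sum>i\<in>UNIV. \<Sum>j\<in>UNIV. a i j x * D2 i j x) + (\<Sum>j\<in>UNIV. b j x * D1 j x)"
  shows "\<exists>r>0. ball x0 r \<subseteq> U \<and> (\<forall>x\<in>ball x0 r. v x = v x0)"
proof -
  define M where "M = v x0"
  have v_cont: "continuous_on S v" if "S \<subseteq> U" for S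
    using d1 has_derivative_continuous that by (fast intro: continuous_at_imp_continuous_on)
  obtain e where e: "e > 0" "cball x0 e \<subseteq> U"
    using U open_contains_cball by blast
  define r where "r = e / 3"
  have r: "r > 0" "cball x0 (3 * r) \<subseteq> U"
    using e by (auto simp: r_def)
  have "v y = M" if y: "y \<in> ball x0 r" for y
  proof (rule ccontr)
    assume "v y \<noteq> M"
    define F where "F = {x \<in> cball x0 (3 * r). v x = M}"
    have "closed F"
      unfolding F_def by (rule continuous_closed_preimage_constant[OF v_cont[OF r(2)]]) simp
    moreover have x0F: "x0 \<in> F"
      using r(1) by (simp add: F_def M_def)
    ultimately obtain z where z: "z \<in> F" "\<And>x. x \<in> F \<Longrightarrow> dist y z \<le> dist y x"
      using distance_attains_inf[of F y] by blast
    define \<rho> where "\<rho> = dist y z"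
    have "z \<noteq> y"
      using z(1) \<open>v y \<noteq> M\<close> by (auto simp: F_def)
    then have \<rho>: "0 < \<rho>" by (simp add: \<rho>_def)
    have yx0: "dist y x0 < r"
      using y by (simp add: dist_commute)
    have \<rho>_le: "\<rho> \<le> dist y x0"
      using z(2)[OF x0F] by (simp add: \<rho>_def)
    have vz: "v z = M"
      using z(1) by (simp add: F_def)
    \<comment> \<open>The ball about the midpoint \<open>y'\<close> with radius \<open>\<rho> / 2\<close> meets \<open>F\<close> only at \<open>z\<close>, unlike the
        ball about \<open>y\<close>, which may touch \<open>F\<close> at several points.\<close>
    define y' where "y' = (1/2) *\<^sub>R (y + z)"
    have median: "(dist x y')\<^sup>2 = ((dist y x)\<^sup>2 + (dist x z)\<^sup>2) / 2 - \<rho>\<^sup>2 / 4" for x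
      unfolding dist_norm power2_norm_eq_inner y'_def \<rho>_def
      by (simp add: inner_add inner_diff inner_commute field_simps)
    have y'z: "dist z y' = \<rho> / 2"
    proof -
      have "(dist z y')\<^sup>2 = (\<rho> / 2)\<^sup>2"
        unfolding median by (simp add: \<rho>_def[symmetric] power2_eq_square)
      then show ?thesis
        using \<rho> by (simp add: power2_eq_iff_nonneg)
    qed
    define K where "K = cball z (\<rho> / 4)"
    have K_3r: "K \<subseteq> cball x0 (3 * r)"
    proof
      fix x assume "x \<in> K"
      then have "dist z x \<le> \<rho> / 4" by (simp add: K_def)
      moreover have "dist x0 x \<le> dist x0 y + dist y z + dist z x"
        using dist_triangle[of x0 x y] dist_triangle[of y x z] by simp
      ultimately show "x \<in> cball x0 (3 * r)"
        using \<rho>_le yx0 r(1) by (simp add: \<rho>_def[symmetric] dist_commute)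
    qed
    with r(2) have KU: "K \<subseteq> U" by blast
    have K: "compact K" "K \<noteq> {}" "z \<in> K"
      using \<rho> by (auto simp: K_def)
    have v_le: "v x \<le> M" if "x \<in> K" for x
      using max KU that by (auto simp: M_def)
    have v_less: "v x < M" if "x \<in> K" "x \<noteq> z" "dist x y' \<le> \<rho> / 2" for x
    proof -
      have "(dist x y')\<^sup>2 \<le> (\<rho> / 2)\<^sup>2"
        using that(3) by (intro power_mono) auto
      then have "(dist y x)\<^sup>2 + (dist x z)\<^sup>2 \<le> \<rho>\<^sup>2"
        unfolding median by (simp add: power2_eq_square)
      moreover have "(dist x z)\<^sup>2 > 0"
        using that(2) by simp
      ultimately have "(dist y x)\<^sup>2 < \<rho>\<^sup>2" by linarith
      then have "dist y x < \<rho>"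
        by (rule power2_less_imp_less) (use \<rho> in simp)
      then have "x \<notin> F"
        using z(2)[of x] by (auto simp: \<rho>_def)
      with K_3r that(1) have "v x \<noteq> M"
        by (auto simp: F_def)
      with v_le[OF that(1)] show ?thesis by simp
    qed
    have y'_K: "x \<noteq> y'" if "x \<in> K" for x
      using that y'z \<rho> by (auto simp: K_def)

    \<comment> \<open>The operator applied to the Gaussian is \<open>2 \<alpha> w (2 \<alpha> A - C)\<close>; on \<open>K\<close> the quadratic part \<open>A\<close>
        is bounded below by some \<open>m > 0\<close> because \<open>y'\<close> is not in \<open>K\<close>.\<close>
    define A where "A x = (\<Sum>i\<in>UNIV. \<Sum>j\<in>UNIV. a i j x * (x - y') $ i * (x - y') $ j)" for x
    define C where "C x = (\<Sum>i\<in>UNIV. a i i x) + (\<Sum>j\<in>UNIV. b j x * (x - y') $ j)" for x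
    have "continuous_on K A"
      unfolding A_def by (intro continuous_intros continuous_on_subset[OF a_cont KU])
    then obtain xm where xm: "xm \<in> K" "\<And>x. x \<in> K \<Longrightarrow> A xm \<le> A x"
      using continuous_attains_inf[OF K(1,2)] by blast
    define m where "m = A xm"
    have m: "m > 0"
      unfolding m_def A_def
    proof (rule pos)
      show "xm \<in> U" using xm(1) KU by blast
      show "\<exists>i. (xm - y') $ i \<noteq> 0"
        using y'_K[OF xm(1)] by (simp add: vec_eq_iff)
    qed
    have "continuous_on K C"
      unfolding C_def by (intro continuous_intros continuous_on_subset[OF a_cont KU] continuous_on_subset[OF b_cont KU])
    then obtain xM where xM: "xM \<in> K" "\<And>x. x \<in> K \<Longrightarrow> C x \<le> C xM"
      using continuous_attains_sup[OF K(1,2)] by blast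
    define \<alpha> where "\<alpha> = (\<bar>C xM\<bar> + 1) / (2 * m)"
    have \<alpha>: "\<alpha> > 0"
      using m by (simp add: \<alpha>_def add_nonneg_pos)
    have AC: "C x < 2 * \<alpha> * A x" if "x \<in> K" for x
    proof -
      have "C x < \<bar>C xM\<bar> + 1"
        using xM(2)[OF that] by linarith
      also have "\<dots> = 2 * \<alpha> * m"
        using m by (simp add: \<alpha>_def)
      also have "\<dots> \<le> 2 * \<alpha> * A x"
        using \<alpha> xm(2)[OF that] by (simp add: m_def)
      finally show ?thesis .
    qed

    define w where "w x = exp (- \<alpha> * ((x - y') \<bullet> (x - y')))" for x
    define W1 where "W1 j x = - 2 * \<alpha> * (x - y') $ j * w x" for j x
    define W2 where "W2 i j x = (4 * \<alpha>\<^sup>2 * (x - y') $ i * (x - y') $ j - (if i = j then 2 * \<alpha> else 0)) * w x" for i j x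
    have w_pos: "w x > 0" for x by (simp add: w_def)
    have w1: "(w has_derivative (\<lambda>h. \<Sum>j\<in>UNIV. h $ j * W1 j x)) (at x)" for x
      unfolding w_def W1_def by (rule barrier_derivatives)
    have w2: "(W1 j has_derivative (\<lambda>h. \<Sum>i\<in>UNIV. h $ i * W2 i j x)) (at x)" for x j
      unfolding w_def W1_def W2_def by (rule barrier_derivatives)
    have Lw: "(\<Sum>i\<in>UNIV. \<Sum>j\<in>UNIV. a i j x * W2 i j x) + (\<Sum>j\<in>UNIV. b j x * W1 j x)
        = 2 * \<alpha> * w x * (2 * \<alpha> * A x - C x)" for x
    proof -
      have "(\<Sum>i\<in>UNIV. \<Sum>j\<in>UNIV. a i j x * W2 i j x)
          = (\<Sum>i\<in>UNIV. \<Sum>j\<in>UNIV. 4 * \<alpha>\<^sup>2 * w x * (a i j x * (x - y') $ i * (x - y') $ j)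
               - (if i = j then 2 * \<alpha> * w x * a i j x else 0))"
        unfolding W2_def by (intro sum.cong refl) (simp add: algebra_simps)
      also have "\<dots> = 4 * \<alpha>\<^sup>2 * w x * A x - 2 * \<alpha> * w x * (\<Sum>i\<in>UNIV. a i i x)"
        by (simp add: sum_subtractf A_def sum_distrib_left)
      finally have 1: "(\<Sum>i\<in>UNIV. \<Sum>j\<in>UNIV. a i j x * W2 i j x) = \<dots>" .
      have 2: "(\<Sum>j\<in>UNIV. b j x * W1 j x) = - 2 * \<alpha> * w x * (\<Sum>j\<in>UNIV. b j x * (x - y') $ j)"
        unfolding W1_def sum_distrib_left by (intro sum.cong refl) simp
      show ?thesis
        unfolding 1 2 C_def by (simp add: algebra_simps power2_eq_square)
    qed
    have w_eq: "w x = exp (- \<alpha> * (dist x y')\<^sup>2)" for x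
      unfolding w_def dist_norm power2_norm_eq_inner ..
    have w_le1: "w x \<le> 1" for x
      using \<alpha> by (simp add: w_eq)
    have w_less: "w x < w z" if "\<rho> / 2 < dist x y'" for x
    proof -
      have "(dist z y')\<^sup>2 < (dist x y')\<^sup>2"
        using that \<rho> unfolding y'z by (intro power_strict_mono) auto
      then show ?thesis
        using \<alpha> by (simp add: w_eq)
    qed

    \<comment> \<open>On the part \<open>S\<close> of the sphere inside the touching ball \<open>v\<close> is below \<open>M\<close> by a fixed \<open>\<delta>\<close>,
        which bounds the admissible multiple of \<open>w\<close>, since \<open>w \<le> 1\<close>.\<close>
    define S where "S = sphere z (\<rho> / 4) \<inter> cball y' (\<rho> / 2)"
    have SK: "S \<subseteq> K"
      by (auto simp: S_def K_def)
    obtain \<delta> where \<delta>: "\<delta> > 0" "\<And>x. x \<in> S \<Longrightarrow> v x \<le> M - \<delta>"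
    proof (cases "S = {}")
      case True
      then show ?thesis using that[of 1] by auto
    next
      case False
      have "compact S" by (simp add: S_def compact_Int_closed)
      then obtain xs where xs: "xs \<in> S" "\<And>x. x \<in> S \<Longrightarrow> v x \<le> v xs"
        using continuous_attains_sup[OF _ False v_cont] SK KU by blast
      have "v xs < M"
        by (rule v_less) (use xs(1) SK \<rho> in \<open>auto simp: S_def dist_commute\<close>)
      then show ?thesis
        using that[of "M - v xs"] xs(2) by auto
    qed
    define \<epsilon> where "\<epsilon> = \<delta> / 2"
    have \<epsilon>: "\<epsilon> > 0" using \<delta>(1) by (simp add: \<epsilon>_def)
    define \<phi> where "\<phi> x = v x + \<epsilon> * w x" for x
    have \<phi>_sphere: "\<phi> x < \<phi> z" if "x \<in> sphere z (\<rho> / 4)" for x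
    proof (cases "dist x y' \<le> \<rho> / 2")
      case True
      then have "v x \<le> M - \<delta>"
        using that by (intro \<delta>(2)) (simp add: S_def dist_commute)
      moreover have "\<epsilon> * w x \<le> \<epsilon>" "0 < \<epsilon> * w z"
        using \<epsilon> w_le1[of x] w_pos[of z] by auto
      ultimately show ?thesis
        using \<delta>(1) unfolding \<phi>_def vz \<epsilon>_def by linarith
    next
      case False
      have "x \<in> K"
        using that by (simp add: K_def)
      then show ?thesis
        using w_less[of x] False v_le[of x] \<epsilon> unfolding \<phi>_def vz by (simp add: add_le_less_mono)
    qed
    have w_cont: "continuous_on K w"
      unfolding w_def by (intro continuous_intros)
    have "continuous_on K \<phi>"
      unfolding \<phi>_def by (intro continuous_intros v_cont[OF KU] w_cont)
    then obtain x where x: "x \<in> K" "\<And>y. y \<in> K \<Longrightarrow> \<phi> y \<le> \<phi> x"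
      using continuous_attains_sup[OF K(1,2)] by blast
    have "x \<notin> sphere z (\<rho> / 4)"
      using \<phi>_sphere[of x] x(2)[OF K(3)] by auto
    with x(1) have xb: "x \<in> ball z (\<rho> / 4)"
      by (simp add: K_def)
    have bK: "ball z (\<rho> / 4) \<subseteq> K"
      by (auto simp: K_def)
    have xU: "x \<in> U" using x(1) KU by blast
    have "(\<Sum>i\<in>UNIV. \<Sum>j\<in>UNIV. a i j x * (D2 i j x + \<epsilon> * W2 i j x))
        + (\<Sum>j\<in>UNIV. b j x * (D1 j x + \<epsilon> * W1 j x)) \<le> 0"
    proof (rule elliptic_nonpos_at_max[of "ball z (\<rho> / 4)" x \<phi> "\<lambda>j x. D1 j x + \<epsilon> * W1 j x"])
      show "\<phi> y \<le> \<phi> x" if "y \<in> ball z (\<rho> / 4)" for y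
        using x(2) bK that by blast
      show "(\<phi> has_derivative (\<lambda>h. \<Sum>j\<in>UNIV. h $ j * (D1 j y + \<epsilon> * W1 j y))) (at y)"
        if "y \<in> ball z (\<rho> / 4)" for y
      proof -
        have "y \<in> U" using that bK KU by blast
        then show ?thesis
          unfolding \<phi>_def
          by (rule has_derivative_eq_rhs[OF has_derivative_add[OF d1 has_derivative_mult_right[OF w1]]])
            (simp add: fun_eq_iff sum_distrib_left sum.distrib distrib_left mult.left_commute)
      qed
      show "((\<lambda>x. D1 j x + \<epsilon> * W1 j x) has_derivative (\<lambda>h. \<Sum>i\<in>UNIV. h $ i * (D2 i j x + \<epsilon> * W2 i j x))) (at x)" for j
        by (rule has_derivative_eq_rhs[OF has_derivative_add[OF d2[OF xU] has_derivative_mult_right[OF w2]]])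
            (simp add: fun_eq_iff sum_distrib_left sum.distrib distrib_left mult.left_commute)
      show "a i j x = a j i x" for i j
        by (rule sym[OF xU])
      show "0 < (\<Sum>i\<in>UNIV. \<Sum>j\<in>UNIV. a i j x * v i * v j)" if "\<exists>i. v i \<noteq> 0" for v
        by (rule pos[OF xU that])
    qed (use xb in simp_all)
    also have "(\<Sum>i\<in>UNIV. \<Sum>j\<in>UNIV. a i j x * (D2 i j x + \<epsilon> * W2 i j x))
      = (\<Sum>i\<in>UNIV. \<Sum>j\<in>UNIV. a i j x * D2 i j x) + \<epsilon> * (\<Sum>i\<in>UNIV. \<Sum>j\<in>UNIV. a i j x * W2 i j x)"
      by (simp add: distrib_left sum.distrib sum_distrib_left mult.left_commute)
    also have "(\<Sum>j\<in>UNIV. b j x * (D1 j x + \<epsilon> * W1 j x))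
      = (\<Sum>j\<in>UNIV. b j x * D1 j x) + \<epsilon> * (\<Sum>j\<in>UNIV. b j x * W1 j x)"
      by (simp add: distrib_left sum.distrib sum_distrib_left mult.left_commute)
    finally have "((\<Sum>i\<in>UNIV. \<Sum>j\<in>UNIV. a i j x * D2 i j x) + (\<Sum>j\<in>UNIV. b j x * D1 j x))
        + \<epsilon> * ((\<Sum>i\<in>UNIV. \<Sum>j\<in>UNIV. a i j x * W2 i j x) + (\<Sum>j\<in>UNIV. b j x * W1 j x)) \<le> 0"
      by (simp add: distrib_left)
    then have "\<epsilon> * (2 * \<alpha> * w x * (2 * \<alpha> * A x - C x)) \<le> 0"
      unfolding Lw using sub[OF xU] by linarith
    moreover have "0 < \<epsilon> * (2 * \<alpha> * w x * (2 * \<alpha> * A x - C x))"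
      using \<epsilon> \<alpha> w_pos[of x] AC[OF x(1)] by simp
    ultimately show False by linarith
  qed
  moreover have "ball x0 r \<subseteq> U"
    using r by (auto simp: subset_iff)
  ultimately show ?thesis
    using r(1) unfolding M_def by blast
qed

section \<open>Inverse matrices\<close>

lemma invertible_matrix_inv:
  assumes "invertible (A :: real ^ 'n ^ 'n)"
  shows "A ** matrix_inv A = mat 1" and "matrix_inv A ** A = mat 1"
  using someI_ex[OF assms[unfolded invertible_def]] by (simp_all add: matrix_inv_def)

lemma posdef_matrix_inverse:
  fixes G :: "real ^ 'n ^ 'n"
  assumes sym: "transpose G = G" and pos: "\<And>v. v \<noteq> 0 \<Longrightarrow> v \<bullet> (G *v v) > 0"
  shows "invertible G"
    and "transpose (matrix_inv G) = matrix_inv G"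
    and "v \<noteq> 0 \<Longrightarrow> v \<bullet> (matrix_inv G *v v) > 0"
proof -
  have "v = 0" if "G *v v = 0" for v
    using pos[of v] that by (cases "v = 0") auto
  then show inv: "invertible G"
    by (simp add: invertible_left_inverse matrix_left_invertible_ker)
  note I = invertible_matrix_inv[OF inv]
  have "transpose (matrix_inv G) = transpose (matrix_inv G) ** (G ** matrix_inv G)"
    by (simp add: I)
  also have "\<dots> = transpose (G ** matrix_inv G) ** matrix_inv G"
    by (simp add: matrix_transpose_mul sym matrix_mul_assoc)
  also have "\<dots> = matrix_inv G"
    by (simp add: I transpose_mat)
  finally show "transpose (matrix_inv G) = matrix_inv G" .
  show "v \<bullet> (matrix_inv G *v v) > 0" if "v \<noteq> 0"
  proof -
    define w where "w = matrix_inv G *v v"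
    have Gw: "G *v w = v"
      by (simp add: w_def matrix_vector_mul_assoc I)
    with that have "w \<noteq> 0" by auto
    from pos[OF this] show ?thesis
      by (simp add: Gw w_def[symmetric] inner_commute)
  qed
qed

text \<open>Cramer's rule writes the entries of the inverse as quotients of polynomials in the entries.\<close>
lemma continuous_on_matrix_inv:
  fixes f :: "'a::topological_space \<Rightarrow> real ^ 'n ^ 'n"
  assumes f: "continuous_on S f" and inv: "\<And>x. x \<in> S \<Longrightarrow> invertible (f x)"
  shows "continuous_on S (\<lambda>x. matrix_inv (f x) $ k $ l)"
proof -
  have *: "matrix_inv A $ k $ l = det (\<chi> i j. if j = k then axis l 1 $ i else A $ i $ j) / det A"
    if "invertible A" for A :: "real ^ 'n ^ 'n"
  proof -
    have "A *v (matrix_inv A *v axis l 1) = axis l 1"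
      by (simp add: matrix_vector_mul_assoc invertible_matrix_inv[OF that])
    moreover have "det A \<noteq> 0"
      using that by (simp add: invertible_det_nz)
    ultimately have "matrix_inv A *v axis l 1 =
        (\<chi> k. det (\<chi> i j. if j = k then axis l 1 $ i else A $ i $ j) / det A)"
      using cramer by blast
    moreover have "(matrix_inv A *v axis l 1) $ k = matrix_inv A $ k $ l"
      by (simp add: matrix_vector_mult_basis column_def)
    ultimately show ?thesis by simp
  qed
  have "continuous_on S (\<lambda>x. det (\<chi> i j. if j = k then axis l 1 $ i else f x $ i $ j) / det (f x))"
  proof (rule continuous_on_divide)
    have c: "continuous_on S (\<lambda>x. if j = k then axis l 1 $ i else f x $ i $ j)" for i j
      by (cases "j = k") (auto intro!: continuous_intros f)
    show "continuous_on S (\<lambda>x. det (\<chi> i j. if j = k then axis l 1 $ i else f x $ i $ j))"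
      unfolding det_def vec_lambda_beta
      by (intro continuous_on_sum continuous_on_mult continuous_on_const continuous_on_prod c)
    show "continuous_on S (\<lambda>x. det (f x))"
      unfolding det_def by (intro continuous_intros f)
    show "\<forall>x\<in>S. det (f x) \<noteq> 0"
      using inv by (simp add: invertible_det_nz)
  qed
  then show ?thesis
    by (rule continuous_on_eq) (simp add: * inv)
qed

section \<open>Smooth functions and fields in a chart\<close>

lemma smooth_onD:
  assumes "smooth_on S f"
  shows "continuous_on S f" and "x \<in> S \<Longrightarrow> f differentiable (at x)"
    and "continuous_on S (\<lambda>x. frechet_derivative f (at x) v)"
proof -
  have k: "higher_differentiable_on k S f" for k
    using assms by (simp add: smooth_on_def)
  show "continuous_on S f" using k[of 0] by simp
  show "f differentiable (at x)" if "x \<in> S" using k[of "Suc 0"] that by simp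
  show "continuous_on S (\<lambda>x. frechet_derivative f (at x) v)" using k[of "Suc 0"] by simp
qed

lemma has_derivative_partials:
  fixes f :: "real ^ 'n \<Rightarrow> real"
  assumes "f differentiable (at x)"
  shows "(f has_derivative (\<lambda>h. \<Sum>i\<in>UNIV. h $ i * frechet_derivative f (at x) (axis i 1))) (at x)"
proof -
  have f: "(f has_derivative frechet_derivative f (at x)) (at x)"
    using assms by (simp add: frechet_derivative_works)
  then have lin: "linear (frechet_derivative f (at x))"
    by (rule has_derivative_linear)
  have "frechet_derivative f (at x) h = (\<Sum>i\<in>UNIV. h $ i * frechet_derivative f (at x) (axis i 1))" for h
  proof -
    have "frechet_derivative f (at x) h = frechet_derivative f (at x) (\<Sum>i\<in>UNIV. h $ i *\<^sub>R axis i 1)"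
      using basis_expansion[of h] by (simp add: scalar_mult_eq_scaleR)
    then show ?thesis
      by (simp add: linear_sum[OF lin] linear_scale[OF lin])
  qed
  then show ?thesis
    by (intro has_derivative_eq_rhs[OF f] ext)
qed

lemma chart_deriv_cinv:
  assumes "x \<in> cran c"
  shows "chart_deriv c i u (cinv c x) = frechet_derivative (\<lambda>x. u (cinv c x)) (at x) (axis i 1)"
  using assms by (simp add: chart_deriv_def f_inv_into_f comp_def)

text \<open>Gives the components of a smooth tensor field, with \<open>L\<close> the projection to an entry, in the
  form that the maximum principle asks for.\<close>
lemma smooth_in_chart_linear:
  fixes F :: "'a \<Rightarrow> 'b::real_normed_vector" and L :: "'b \<Rightarrow> real"
  assumes F: "smooth_in_chart c F" and L: "bounded_linear L"
  shows "continuous_on (cran c) (\<lambda>x. L (F (cinv c x)))"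
    and "x \<in> cran c \<Longrightarrow> ((\<lambda>x. L (F (cinv c x))) has_derivative
        (\<lambda>h. \<Sum>i\<in>UNIV. h $ i * chart_deriv c i (\<lambda>q. L (F q)) (cinv c x))) (at x)"
    and "continuous_on (cran c) (\<lambda>x. chart_deriv c i (\<lambda>q. L (F q)) (cinv c x))"
proof -
  note S = smooth_onD[OF F[unfolded smooth_in_chart_def], unfolded comp_def]
  show "continuous_on (cran c) (\<lambda>x. L (F (cinv c x)))"
    by (rule bounded_linear.continuous_on[OF L S(1)])
  have d: "((\<lambda>x. L (F (cinv c x))) has_derivative
      (\<lambda>h. L (frechet_derivative (\<lambda>x. F (cinv c x)) (at x) h))) (at x)" if "x \<in> cran c" for x
    by (rule bounded_linear.has_derivative[OF L])
      (use S(2)[OF that] in \<open>simp add: frechet_derivative_works[symmetric]\<close>)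
  show "((\<lambda>x. L (F (cinv c x))) has_derivative
        (\<lambda>h. \<Sum>i\<in>UNIV. h $ i * chart_deriv c i (\<lambda>q. L (F q)) (cinv c x))) (at x)" if "x \<in> cran c"
    unfolding chart_deriv_cinv[OF that]
    by (rule has_derivative_partials[OF differentiableI[OF d[OF that]]])
  have "continuous_on (cran c) (\<lambda>x. L (frechet_derivative (\<lambda>x. F (cinv c x)) (at x) (axis i 1)))"
    by (rule bounded_linear.continuous_on[OF L S(3)])
  then show "continuous_on (cran c) (\<lambda>x. chart_deriv c i (\<lambda>q. L (F q)) (cinv c x))"
    by (rule continuous_on_eq)
      (simp only: chart_deriv_cinv frechet_derivative_at[OF d, symmetric])
qed

lemma is_chartD:
  assumes "is_chart T c"
  shows "continuous_map (subtopology T (cdom c)) (top_of_set (cran c)) (cmap c)"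
    and "openin T (cdom c)" and "p \<in> cdom c \<Longrightarrow> cinv c (cmap c p) = p"
proof -
  have h: "homeomorphic_map (subtopology T (cdom c)) (top_of_set (cran c)) (cmap c)"
    and o: "openin T (cdom c)"
    using assms by (auto simp: is_chart_def)
  show "openin T (cdom c)" by fact
  show "continuous_map (subtopology T (cdom c)) (top_of_set (cran c)) (cmap c)"
    by (rule homeomorphic_imp_continuous_map[OF h])
  have "inj_on (cmap c) (cdom c)"
    using homeomorphic_imp_injective_map[OF h] openin_subset[OF o]
    by (simp add: topspace_subtopology Int_absorb1)
  then show "p \<in> cdom c \<Longrightarrow> cinv c (cmap c p) = p"
    by (rule inv_into_f_f)
qed

section \<open>Harmonic functions on a compact manifold\<close>

text \<open>In the coordinates \<open>x\<close> of the chart, with \<open>g\<^sup>i\<^sup>j\<close> denoted by \<open>a\<close>, the equation \<open>div Y = 0\<close> for \<open>Y = \<nabla>u\<close>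
  is the elliptic equation \<open>a\<^sup>i\<^sup>j \<partial>\<^sub>i \<partial>\<^sub>j u + b\<^sup>l \<partial>\<^sub>l u = 0\<close>. Instead of differentiating the inverse metric,
  the derivatives of \<open>\<partial>\<^sub>j u = g\<^sub>j\<^sub>k Y\<^sup>k\<close> are taken; they are
  \<open>\<partial>\<^sub>i \<partial>\<^sub>j u = (\<partial>\<^sub>i g\<^sub>j\<^sub>k) Y\<^sup>k + g\<^sub>j\<^sub>k \<partial>\<^sub>i Y\<^sup>k\<close>, and contraction with \<open>a\<^sup>i\<^sup>j\<close> turns the last term into
  \<open>\<partial>\<^sub>i Y\<^sup>i\<close>, the leading part of the divergence.\<close>
lemma harmonic_constant_near_max:
  fixes c :: "('a, 'n::finite) chart"
  assumes chart: "is_chart T c"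
    and g_smooth: "smooth_in_chart c (g c)"
    and g_sym: "\<And>p. p \<in> cdom c \<Longrightarrow> transpose (g c p) = g c p"
    and g_pos: "\<And>p v. p \<in> cdom c \<Longrightarrow> v \<noteq> 0 \<Longrightarrow> v \<bullet> (g c p *v v) > 0"
    and u_diff: "\<And>x. x \<in> cran c \<Longrightarrow> (\<lambda>x. u (cinv c x)) differentiable (at x)"
    and Y_smooth: "smooth_in_chart c (Y c)"
    and Y_grad: "\<And>p. p \<in> cdom c \<Longrightarrow> Y c p = gradient g u c p"
    and Y_div: "\<And>p. p \<in> cdom c \<Longrightarrow> divergence g Y c p = 0"
    and p0: "p0 \<in> cdom c"
    and max: "\<And>p. p \<in> cdom c \<Longrightarrow> u p \<le> u p0"
  shows "\<exists>V. openin T V \<and> p0 \<in> V \<and> (\<forall>p\<in>V. u p = u p0)"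
proof -
  define U where "U = cran c"
  define \<xi> where "\<xi> = cinv c"
  note cont = is_chartD[OF chart]
  have U: "open U" using chart by (simp add: U_def is_chart_def)
  have \<xi>: "\<xi> x \<in> cdom c" if "x \<in> U" for x
    using that unfolding \<xi>_def U_def by (rule inv_into_into)
  have \<xi>_cmap: "\<xi> (cmap c p) = p" if "p \<in> cdom c" for p
    using cont(3)[OF that] by (simp add: \<xi>_def)

  \<comment> \<open>Coordinate expressions of \<open>g\<close> and \<open>Y\<close> and of their partial derivatives; \<open>q\<close> and \<open>\<beta>\<close> are the
      coefficients of \<open>Y\<^sup>k\<close> in \<open>a\<^sup>i\<^sup>j \<partial>\<^sub>i \<partial>\<^sub>j u\<close> and in the divergence.\<close>
  define D1 where "D1 j x = chart_deriv c j u (\<xi> x)" for j x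
  define \<gamma> where "\<gamma> j k x = g c (\<xi> x) $ j $ k" for j k x
  define d\<gamma> where "d\<gamma> i j k x = chart_deriv c i (\<lambda>q. g c q $ j $ k) (\<xi> x)" for i j k x
  define \<eta> where "\<eta> k x = Y c (\<xi> x) $ k" for k x
  define d\<eta> where "d\<eta> i k x = chart_deriv c i (\<lambda>q. Y c q $ k) (\<xi> x)" for i k x
  define a where "a i j x = inv_metric g c (\<xi> x) $ i $ j" for i j x
  define \<beta> where "\<beta> k x = (\<Sum>i\<in>UNIV. christoffel g c i i k (\<xi> x))" for k x
  define q where "q k x = (\<Sum>i\<in>UNIV. \<Sum>j\<in>UNIV. a i j x * d\<gamma> i j k x)" for k x
  define b where "b l x = (\<Sum>k\<in>UNIV. (\<beta> k x - q k x) * a k l x)" for l x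
  define D2 where "D2 i j x = (\<Sum>k\<in>UNIV. d\<gamma> i j k x * \<eta> k x + \<gamma> j k x * d\<eta> i k x)" for i j x

  have comp2: "bounded_linear (\<lambda>A :: real ^ 'n ^ 'n. A $ j $ k)" for j k
    by (rule bounded_linear_compose[OF bounded_linear_vec_nth bounded_linear_vec_nth])
  note \<gamma> = smooth_in_chart_linear[OF g_smooth comp2, folded \<xi>_def U_def, folded \<gamma>_def d\<gamma>_def]
  note \<eta> = smooth_in_chart_linear[OF Y_smooth bounded_linear_vec_nth, folded \<xi>_def U_def, folded \<eta>_def d\<eta>_def]
  have G: "invertible (g c (\<xi> x))"
      "transpose (matrix_inv (g c (\<xi> x))) = matrix_inv (g c (\<xi> x))"
      "\<And>v. v \<noteq> 0 \<Longrightarrow> v \<bullet> (matrix_inv (g c (\<xi> x)) *v v) > 0" if "x \<in> U" for x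
    using posdef_matrix_inverse[OF g_sym[OF \<xi>[OF that]] g_pos[OF \<xi>[OF that]]] by blast+

  have \<eta>_D1: "\<eta> k x = (\<Sum>l\<in>UNIV. a k l x * D1 l x)" if "x \<in> U" for k x
    unfolding \<eta>_def a_def D1_def Y_grad[OF \<xi>[OF that]] gradient_def
    by (simp add: matrix_vector_mult_def)
  have D1_\<eta>: "D1 j x = (\<Sum>k\<in>UNIV. \<gamma> j k x * \<eta> k x)" if "x \<in> U" for j x
  proof -
    have "g c (\<xi> x) *v Y c (\<xi> x) = (\<chi> j. D1 j x)"
      unfolding Y_grad[OF \<xi>[OF that]] gradient_def inv_metric_def D1_def
      by (simp add: matrix_vector_mul_assoc invertible_matrix_inv[OF G(1)[OF that]])
    then have "(g c (\<xi> x) *v Y c (\<xi> x)) $ j = D1 j x" by simp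
    then show ?thesis
      by (simp add: matrix_vector_mult_def \<gamma>_def \<eta>_def)
  qed
  have a_\<gamma>: "(\<Sum>j\<in>UNIV. a i j x * \<gamma> j k x) = (if i = k then 1 else 0)" if "x \<in> U" for i k x
  proof -
    have "(inv_metric g c (\<xi> x) ** g c (\<xi> x)) $ i $ k = mat 1 $ i $ k"
      unfolding inv_metric_def invertible_matrix_inv[OF G(1)[OF that]] ..
    then show ?thesis
      by (simp add: matrix_matrix_mult_def mat_def a_def \<gamma>_def)
  qed

  have a_cont: "continuous_on U (a i j)" for i j
    unfolding a_def inv_metric_def
  proof (rule continuous_on_matrix_inv[OF _ G(1)])
    show "continuous_on U (\<lambda>x. g c (\<xi> x))"
      using smooth_onD(1)[OF g_smooth[unfolded smooth_in_chart_def]]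
      by (simp add: U_def \<xi>_def comp_def)
  qed
  have \<beta>_cont: "continuous_on U (\<beta> k)" for k
    unfolding \<beta>_def christoffel_def a_def[symmetric] d\<gamma>_def[symmetric]
    by (intro continuous_intros a_cont \<gamma>(3))
  have b_cont: "continuous_on U (b l)" for l
    unfolding b_def q_def
    by (intro continuous_intros a_cont \<beta>_cont \<gamma>(3))

  have "\<exists>r>0. ball (cmap c p0) r \<subseteq> U \<and> (\<forall>x\<in>ball (cmap c p0) r. u (\<xi> x) = u (\<xi> (cmap c p0)))"
  proof (rule strong_maximum_principle[OF U, of _ "\<lambda>x. u (\<xi> x)" D1 D2 a b])
    show "cmap c p0 \<in> U" using p0 by (simp add: U_def)
    show "u (\<xi> x) \<le> u (\<xi> (cmap c p0))" if "x \<in> U" for x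
      using max[OF \<xi>[OF that]] by (simp add: \<xi>_cmap p0)
    show "((\<lambda>x. u (\<xi> x)) has_derivative (\<lambda>h. \<Sum>j\<in>UNIV. h $ j * D1 j x)) (at x)" if "x \<in> U" for x
      using has_derivative_partials[OF u_diff] that
      by (simp add: D1_def \<xi>_def chart_deriv_cinv U_def)
    show "(D1 j has_derivative (\<lambda>h. \<Sum>i\<in>UNIV. h $ i * D2 i j x)) (at x)" if x: "x \<in> U" for x j
    proof (rule has_derivative_transform_within_open[OF _ U x])
      show "((\<lambda>x. \<Sum>k\<in>UNIV. \<gamma> j k x * \<eta> k x) has_derivative (\<lambda>h. \<Sum>i\<in>UNIV. h $ i * D2 i j x)) (at x)"
      proof (rule has_derivative_eq_rhs[OF has_derivative_sum[OF has_derivative_mult[OF \<gamma>(2)[OF x] \<eta>(2)[OF x]]]], rule ext)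
        fix h :: "real ^ 'n"
        have "(\<Sum>k\<in>UNIV. \<gamma> j k x * (\<Sum>i\<in>UNIV. h $ i * d\<eta> i k x) + (\<Sum>i\<in>UNIV. h $ i * d\<gamma> i j k x) * \<eta> k x)
            = (\<Sum>k\<in>UNIV. \<Sum>i\<in>UNIV. h $ i * (d\<gamma> i j k x * \<eta> k x + \<gamma> j k x * d\<eta> i k x))"
          unfolding sum_distrib_left sum_distrib_right sum.distrib[symmetric]
          by (intro sum.cong refl) (simp add: algebra_simps)
        also have "\<dots> = (\<Sum>i\<in>UNIV. h $ i * D2 i j x)"
          unfolding D2_def sum_distrib_left by (rule sum.swap)
        finally show "(\<Sum>k\<in>UNIV. \<gamma> j k x * (\<Sum>i\<in>UNIV. h $ i * d\<eta> i k x) + (\<Sum>i\<in>UNIV. h $ i * d\<gamma> i j k x) * \<eta> k x)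
            = (\<Sum>i\<in>UNIV. h $ i * D2 i j x)" .
      qed
    qed (simp add: D1_\<eta>)
    show "continuous_on U (a i j)" for i j by (rule a_cont)
    show "continuous_on U (b j)" for j by (rule b_cont)
    show "a i j x = a j i x" if "x \<in> U" for x i j
    proof -
      have "transpose (matrix_inv (g c (\<xi> x))) $ i $ j = matrix_inv (g c (\<xi> x)) $ i $ j"
        by (simp only: G(2)[OF that])
      then show ?thesis
        by (simp add: transpose_def a_def inv_metric_def)
    qed
    show "0 < (\<Sum>i\<in>UNIV. \<Sum>j\<in>UNIV. a i j x * v i * v j)" if "x \<in> U" "\<exists>i. v i \<noteq> 0" for x v
    proof -
      have "(\<chi> i. v i) \<noteq> 0" using that(2) by (simp add: vec_eq_iff)
      from G(3)[OF that(1) this] show ?thesis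
        by (simp add: a_def inv_metric_def inner_vec_def matrix_vector_mult_def sum_distrib_left ac_simps)
    qed
    show "0 \<le> (\<Sum>i\<in>UNIV. \<Sum>j\<in>UNIV. a i j x * D2 i j x) + (\<Sum>l\<in>UNIV. b l x * D1 l x)" if x: "x \<in> U" for x
    proof -
      have "(\<Sum>i\<in>UNIV. \<Sum>j\<in>UNIV. a i j x * D2 i j x)
          = (\<Sum>i\<in>UNIV. \<Sum>j\<in>UNIV. \<Sum>k\<in>UNIV. a i j x * d\<gamma> i j k x * \<eta> k x)
          + (\<Sum>i\<in>UNIV. \<Sum>j\<in>UNIV. \<Sum>k\<in>UNIV. a i j x * \<gamma> j k x * d\<eta> i k x)"
        unfolding D2_def sum_distrib_left sum.distrib[symmetric]
        by (intro sum.cong refl) (simp add: algebra_simps)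
      also have "(\<Sum>i\<in>UNIV. \<Sum>j\<in>UNIV. \<Sum>k\<in>UNIV. a i j x * d\<gamma> i j k x * \<eta> k x)
          = (\<Sum>k\<in>UNIV. q k x * \<eta> k x)"
      proof -
        have "(\<Sum>i\<in>UNIV. \<Sum>j\<in>UNIV. \<Sum>k\<in>UNIV. a i j x * d\<gamma> i j k x * \<eta> k x)
            = (\<Sum>i\<in>UNIV. \<Sum>k\<in>UNIV. \<Sum>j\<in>UNIV. a i j x * d\<gamma> i j k x * \<eta> k x)"
          by (rule sum.cong[OF refl]) (rule sum.swap)
        also have "\<dots> = (\<Sum>k\<in>UNIV. \<Sum>i\<in>UNIV. \<Sum>j\<in>UNIV. a i j x * d\<gamma> i j k x * \<eta> k x)"
          by (rule sum.swap)
        finally show ?thesis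
          unfolding q_def sum_distrib_right .
      qed
      also have "(\<Sum>i\<in>UNIV. \<Sum>j\<in>UNIV. \<Sum>k\<in>UNIV. a i j x * \<gamma> j k x * d\<eta> i k x)
          = (\<Sum>i\<in>UNIV. d\<eta> i i x)"
      proof (rule sum.cong[OF refl])
        fix i
        have "(\<Sum>j\<in>UNIV. \<Sum>k\<in>UNIV. a i j x * \<gamma> j k x * d\<eta> i k x)
            = (\<Sum>k\<in>UNIV. (\<Sum>j\<in>UNIV. a i j x * \<gamma> j k x) * d\<eta> i k x)"
          unfolding sum_distrib_right by (rule sum.swap)
        then show "(\<Sum>j\<in>UNIV. \<Sum>k\<in>UNIV. a i j x * \<gamma> j k x * d\<eta> i k x) = d\<eta> i i x"
          by (simp add: a_\<gamma>[OF x] mult_delta_left)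
      qed
      finally have 1: "(\<Sum>i\<in>UNIV. \<Sum>j\<in>UNIV. a i j x * D2 i j x)
          = (\<Sum>k\<in>UNIV. q k x * \<eta> k x) + (\<Sum>i\<in>UNIV. d\<eta> i i x)" .
      have 2: "(\<Sum>l\<in>UNIV. b l x * D1 l x) = (\<Sum>k\<in>UNIV. (\<beta> k x - q k x) * \<eta> k x)"
      proof -
        have "(\<Sum>l\<in>UNIV. b l x * D1 l x)
            = (\<Sum>l\<in>UNIV. \<Sum>k\<in>UNIV. (\<beta> k x - q k x) * a k l x * D1 l x)"
          unfolding b_def sum_distrib_right ..
        also have "\<dots> = (\<Sum>k\<in>UNIV. \<Sum>l\<in>UNIV. (\<beta> k x - q k x) * a k l x * D1 l x)"
          by (rule sum.swap)
        finally show ?thesis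
          by (simp add: \<eta>_D1[OF x] sum_distrib_left mult.assoc)
      qed
      have "divergence g Y c (\<xi> x)
          = (\<Sum>i\<in>UNIV. d\<eta> i i x) + (\<Sum>i\<in>UNIV. \<Sum>k\<in>UNIV. christoffel g c i i k (\<xi> x) * \<eta> k x)"
        by (simp add: divergence_def d\<eta>_def \<eta>_def sum.distrib)
      also have "(\<Sum>i\<in>UNIV. \<Sum>k\<in>UNIV. christoffel g c i i k (\<xi> x) * \<eta> k x) = (\<Sum>k\<in>UNIV. \<beta> k x * \<eta> k x)"
        unfolding \<beta>_def sum_distrib_right by (rule sum.swap)
      finally show ?thesis
        unfolding 1 2 using Y_div[OF \<xi>[OF x]]
        by (simp add: left_diff_distrib sum_subtractf)
    qed
  qed
  then obtain r where r: "r > 0" "ball (cmap c p0) r \<subseteq> U"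
      and const: "\<And>x. x \<in> ball (cmap c p0) r \<Longrightarrow> u (\<xi> x) = u p0"
    using \<xi>_cmap[OF p0] by auto
  define V where "V = {p \<in> topspace (subtopology T (cdom c)). cmap c p \<in> ball (cmap c p0) r}"
  have "openin (top_of_set U) (ball (cmap c p0) r)"
    using r(2) by (simp add: openin_open_eq U)
  then have "openin (subtopology T (cdom c)) V"
    unfolding V_def U_def by (rule openin_continuous_map_preimage[OF cont(1)])
  then have "openin T V"
    using cont(2) by (rule openin_trans_full)
  moreover have "p0 \<in> V"
    using p0 r(1) openin_subset[OF cont(2)] by (auto simp: V_def)
  moreover have "u p = u p0" if "p \<in> V" for p
    using const[of "cmap c p"] \<xi>_cmap[of p] that by (auto simp: V_def)
  ultimately show ?thesis by blast
qed

lemma smooth_function_continuous: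
  assumes A: "smooth_atlas T A" and u: "smooth_function A u"
  shows "continuous_map T euclideanreal u"
proof (rule pasting_lemma[where I = A and T = cdom and f = "\<lambda>_. u"])
  fix c assume c: "c \<in> A"
  have chart: "is_chart T c"
    using A c by (simp add: smooth_atlas_def)
  show "openin T (cdom c)"
    by (rule is_chartD[OF chart])
  have "smooth_on (cran c) (u \<circ> cinv c)"
    using u c by (simp add: smooth_function_def smooth_in_chart_def)
  then have "continuous_map (top_of_set (cran c)) euclideanreal (u \<circ> cinv c)"
    by (simp only: continuous_map_iff_continuous smooth_onD(1))
  then have "continuous_map (subtopology T (cdom c)) euclideanreal ((u \<circ> cinv c) \<circ> cmap c)"
    by (rule continuous_map_compose[OF is_chartD(1)[OF chart]])
  then show "continuous_map (subtopology T (cdom c)) euclideanreal u"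
    by (rule continuous_map_eq) (simp add: is_chartD(3)[OF chart])
next
  fix p assume "p \<in> topspace T"
  then have "p \<in> (\<Union>c\<in>A. cdom c)"
    using A by (simp add: smooth_atlas_def)
  then show "\<exists>c. c \<in> A \<and> p \<in> cdom c \<and> u p = u p"
    by blast
qed simp

lemma gradient_diff:
  assumes f: "smooth_in_chart c f" and h: "smooth_in_chart c h" and p: "p \<in> cdom c"
  shows "gradient g (\<lambda>p. f p - h p) c p = gradient g f c p - gradient g h c p"
proof -
  have x: "cmap c p \<in> cran c" using p by simp
  have "frechet_derivative ((\<lambda>p. f p - h p) \<circ> cinv c) (at (cmap c p))
      = (\<lambda>v. frechet_derivative (f \<circ> cinv c) (at (cmap c p)) v - frechet_derivative (h \<circ> cinv c) (at (cmap c p)) v)"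
  proof (rule frechet_derivative_at[symmetric])
    have "((\<lambda>x. (f \<circ> cinv c) x - (h \<circ> cinv c) x) has_derivative
      (\<lambda>v. frechet_derivative (f \<circ> cinv c) (at (cmap c p)) v - frechet_derivative (h \<circ> cinv c) (at (cmap c p)) v))
      (at (cmap c p))"
      using smooth_onD(2)[OF f[unfolded smooth_in_chart_def] x] smooth_onD(2)[OF h[unfolded smooth_in_chart_def] x]
      unfolding frechet_derivative_works by (rule has_derivative_diff)
    then show "((\<lambda>p. f p - h p) \<circ> cinv c has_derivative
      (\<lambda>v. frechet_derivative (f \<circ> cinv c) (at (cmap c p)) v - frechet_derivative (h \<circ> cinv c) (at (cmap c p)) v))
      (at (cmap c p))"
      by (simp add: comp_def)
  qed
  then have "(\<chi> j. chart_deriv c j (\<lambda>p. f p - h p) p) = (\<chi> j. chart_deriv c j f p) - (\<chi> j. chart_deriv c j h p)"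
    by (simp add: chart_deriv_def vec_eq_iff)
  then show ?thesis
    by (simp add: gradient_def matrix_vector_mult_diff_distrib)
qed

text \<open>The set where \<open>u\<close> attains its maximum is nonempty by compactness, closed by continuity and open by
  the strong maximum principle, so it is everything. The gradient is given as a separate
  vector field \<open>Y\<close>, equal to it on the chart domains only: values of component functions outside
  the chart domains carry no meaning.\<close>
theorem harmonic_function_constant:
  fixes A :: "('a, 'n::finite) chart set"
  assumes compact: "compact_space T" and conn: "connected_space T" and A: "smooth_atlas T A"
    and g: "riemannian_metric A g" and Y: "smooth_vector_field A Y"
    and u_cont: "continuous_map T euclideanreal u"
    and u_diff: "\<And>c x. c \<in> A \<Longrightarrow> x \<in> cran c \<Longrightarrow> (\<lambda>x. u (cinv c x)) differentiable (at x)"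
    and Y_grad: "\<And>c p. c \<in> A \<Longrightarrow> p \<in> cdom c \<Longrightarrow> Y c p = gradient g u c p"
    and Y_div: "\<And>c p. c \<in> A \<Longrightarrow> p \<in> cdom c \<Longrightarrow> divergence g Y c p = 0"
  shows "\<exists>C. \<forall>p\<in>topspace T. u p = C"
proof (cases "topspace T = {}")
  case True
  then show ?thesis by simp
next
  case False
  have "compact (u ` topspace T)"
    using image_compactin[OF _ u_cont] compact by (auto simp: compact_space_def)
  then obtain pm where pm: "pm \<in> topspace T" "\<And>p. p \<in> topspace T \<Longrightarrow> u p \<le> u pm"
    using compact_attains_sup[of "u ` topspace T"] False by auto
  define W where "W = {p \<in> topspace T. u p \<in> {u pm}}"
  have "closedin T W"
    unfolding W_def by (rule closedin_continuous_map_preimage[OF u_cont]) simp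
  moreover have "openin T W"
  proof (subst openin_subopen, intro ballI)
    fix p assume "p \<in> W"
    then have p: "p \<in> topspace T" "u p = u pm" by (auto simp: W_def)
    then have "p \<in> (\<Union>c\<in>A. cdom c)"
      using A by (simp add: smooth_atlas_def)
    then obtain c where c: "c \<in> A" "p \<in> cdom c"
      by blast
    have chart: "is_chart T c"
      using A c(1) by (simp add: smooth_atlas_def)
    have dom: "cdom c \<subseteq> topspace T"
      using chart by (auto simp: is_chart_def dest: openin_subset)
    have "\<exists>V. openin T V \<and> p \<in> V \<and> (\<forall>p'\<in>V. u p' = u p)"
    proof (rule harmonic_constant_near_max[where g = g and Y = Y and u = u, OF chart _ _ _ u_diff[OF c(1)] _ Y_grad[OF c(1)] Y_div[OF c(1)] c(2)])
      show "smooth_in_chart c (g c)"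
        using g c(1) unfolding riemannian_metric_def by blast
      show "transpose (g c q) = g c q" if "q \<in> cdom c" for q
        using g c(1) that unfolding riemannian_metric_def by blast
      show "0 < v \<bullet> (g c q *v v)" if "q \<in> cdom c" "v \<noteq> 0" for q v
        using g c(1) that unfolding riemannian_metric_def by blast
      show "smooth_in_chart c (Y c)"
        using Y c(1) by (simp add: smooth_vector_field_def)
      show "u q \<le> u p" if "q \<in> cdom c" for q
        unfolding p(2) using pm(2) dom that by blast
    qed
    then obtain V where V: "openin T V" "p \<in> V" "\<And>p'. p' \<in> V \<Longrightarrow> u p' = u p"
      by blast
    have "V \<subseteq> W"
    proof
      fix p' assume "p' \<in> V"
      then show "p' \<in> W"
        using openin_subset[OF V(1)] V(3)[of p'] p(2) by (auto simp: W_def)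
    qed
    with V show "\<exists>V. openin T V \<and> p \<in> V \<and> V \<subseteq> W" by blast
  qed
  moreover have "pm \<in> W"
    using pm(1) by (simp add: W_def)
  ultimately have "W = topspace T"
    using conn unfolding connected_space_clopen_in by blast
  then have "u p = u pm" if "p \<in> topspace T" for p
    using that unfolding W_def by blast
  then show ?thesis by blast
qed

section \<open>Uniqueness of the Hodge-de Rham potential\<close>

text \<open>The divergence-free part of \<open>X = \<nabla>f\<close> is \<open>Y = \<nabla>f - \<nabla>h = \<nabla>(f - h)\<close>.\<close>
theorem theorem2p2:
  fixes T :: "'a topology"
    and A B :: "('a, 'n::finite) chart set"
    and g :: "('a, 'n) tensor2"
    and X :: "('a, 'n) vfield"
    and lam :: real
    and f h :: "'a \<Rightarrow> real"
  assumes "CARD('n) \<ge> 2"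
    and "compact_space T"
    and "orientation_atlas T A B"
    and "gradient_yamabe_soliton T A g X lam f"
    and "hodge_de_rham_potential A g X h"
  shows "\<exists>C. \<forall>p\<in>topspace T. f p = h p + C"
proof -
  have A: "smooth_atlas T A" and conn: "connected_space T" and g: "riemannian_metric A g"
    and f: "smooth_function A f" and X: "\<And>c p. c \<in> A \<Longrightarrow> p \<in> cdom c \<Longrightarrow> X c p = gradient g f c p"
    using assms(4) by (auto simp: gradient_yamabe_soliton_def yamabe_soliton_def smooth_manifold_def)
  have h: "smooth_function A h"
    using assms(5) by (simp add: hodge_de_rham_potential_def)
  obtain Y where Y: "smooth_vector_field A Y"
    and div: "\<And>c p. c \<in> A \<Longrightarrow> p \<in> cdom c \<Longrightarrow> divergence g Y c p = 0"
    and XY: "\<And>c p. c \<in> A \<Longrightarrow> p \<in> cdom c \<Longrightarrow> X c p = Y c p + gradient g h c p"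
    using assms(5) unfolding hodge_de_rham_potential_def by blast
  have fc: "smooth_in_chart c f" and hc: "smooth_in_chart c h" if "c \<in> A" for c
    using f h that by (simp_all add: smooth_function_def)
  have "\<exists>C. \<forall>p\<in>topspace T. f p - h p = C"
  proof (rule harmonic_function_constant[OF assms(2) conn A g Y])
    show "continuous_map T euclideanreal (\<lambda>p. f p - h p)"
      by (intro continuous_map_diff smooth_function_continuous[OF A] f h)
    show "(\<lambda>x. f (cinv c x) - h (cinv c x)) differentiable (at x)" if "c \<in> A" "x \<in> cran c" for c x
      using smooth_onD(2)[OF fc[unfolded smooth_in_chart_def], OF that]
        smooth_onD(2)[OF hc[unfolded smooth_in_chart_def], OF that]
      by (intro differentiable_diff) (simp_all add: comp_def)
    show "Y c p = gradient g (\<lambda>p. f p - h p) c p" if "c \<in> A" "p \<in> cdom c" for c p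
    proof -
      have "Y c p = X c p - gradient g h c p"
        by (simp add: XY[OF that])
      then show ?thesis
        by (simp add: gradient_diff[OF fc[OF that(1)] hc[OF that(1)] that(2)] X[OF that])
    qed
  qed (rule div)
  then obtain C where "\<And>p. p \<in> topspace T \<Longrightarrow> f p - h p = C"
    by blast
  then show ?thesis
    by (intro exI[of _ C] ballI) (simp add: algebra_simps)
qed

end
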